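(* Let $\Gamma$ be an abelian group and let $M$ be a conical refinement $\Gamma$-monoid. Then $\operatorname{udim}'(M)=\operatorname{udim}(M)$.
   Context: All monoids are commutative, written additively with unit $0$. A $\Gamma$-monoid is a monoid $M$ with an action of the abelian group $\Gamma$ by monoid automorphisms. The algebraic preorder on $M$ is: $a\le b$ iff $b=a+c$ for some $c\in M$. $M$ is conical if $a+b=0$ implies $a=b=0$. $M$ is a refinement monoid if whenever $a_0+a_1=b_0+b_1$ there are $c_{00},c_{01},c_{10},c_{11}\in M$ with $a_0=c_{00}+c_{01}$, $a_1=c_{10}+c_{11}$, $b_0=c_{00}+c_{10}$, $b_1=c_{01}+c_{11}$. A $\Gamma$-order ideal of $M$ is a submonoid $I$ that is closed under the action of $\Gamma$ and such that $x\in I$, $y\le x$ imply $y\in I$. For a family of $\Gamma$-order ideals, $\sum_s I_s$ is the set of finite sums of elements of the $I_s$ (in a refinement monoid this is again a $\Gamma$-order ideal). The sum is called direct, written $\bigoplus_s I_s$, if $I_i\cap\sum_{s\ne i}I_s=\{0\}$ for every index $i$. A $\Gamma$-order ideal $I$ of $M$ is essential if $I\cap J\neq\{0\}$ for every nonzero $\Gamma$-order ideal $J$ of $M$. A nonzero $\Gamma$-order ideal $I$ is uniform if any two nonzero $\Gamma$-order ideals contained in $I$ have nonzero intersection. Two $\Gamma$-order ideals $I,J$ are incomparable if for all nonzero $a\in I$, $b\in J$ neither $a\le b$ nor $b\le a$ holds (equivalently, $I\cap J=\{0\}$). The uniform dimension is $\operatorname{udim}(M)=\sup\{k \mid M\text{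 contains } k \text{ pairwise incomparable nonzero } \Gamma\text{-order ideals}\}\in\{0,1,2,\dots\}\cup\{\infty\}$. For a conical refinement $\Gamma$-monoid $M$, define $\operatorname{udim}'(M)=n$ if there exists an essential $\Gamma$-order ideal of $M$ that decomposes as a direct sum of $n$ uniform $\Gamma$-order ideals (this $n$ is unique when it exists; the empty direct sum, $n=0$, is $\{0\}$); if no such $n$ exists, $\operatorname{udim}'(M)=\infty$. *)

theory Defs
  imports "HOL-Library.Extended_Nat"
begin

locale gamma_monoid =
  fixes act :: "'g::ab_group_add \<Rightarrow> 'm::comm_monoid_add \<Rightarrow> 'm"
  assumes act_zero_left: "act 0 x = x"
    and act_add_left: "act (g + h) x = act g (act h x)"
    and act_zero_right: "act g 0 = 0"
    and act_add_right: "act g (x + y) = act g x + act g y"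

locale conical_refinement_gamma_monoid = gamma_monoid act
  for act :: "'g::ab_group_add \<Rightarrow> 'm::comm_monoid_add \<Rightarrow> 'm" +
  assumes conical: "(a::'m) + b = 0 \<Longrightarrow> a = 0 \<and> b = 0"
    and refinement: "(a0::'m) + a1 = b0 + b1 \<Longrightarrow>
      \<exists>c00 c01 c10 c11. a0 = c00 + c01 \<and> a1 = c10 + c11 \<and> b0 = c00 + c10 \<and> b1 = c01 + c11"

definition alg_le :: "'m::comm_monoid_add \<Rightarrow> 'm \<Rightarrow> bool"
  where "alg_le a b \<longleftrightarrow> (\<exists>c. b = a + c)"

definition incomparable :: "'m::comm_monoid_add set \<Rightarrow> 'm set \<Rightarrow> bool"
  where "incomparable I J \<longleftrightarrow>
    (\<forall>a\<in>I. \<forall>b\<in>J. a \<noteq> 0 \<longrightarrow> b \<noteq> 0 \<longrightarrow> \<not> alg_le a b \<and> \<not> alg_le b a)"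

definition ideal_sum :: "'i set \<Rightarrow> ('i \<Rightarrow> 'm::comm_monoid_add set) \<Rightarrow> 'm set"
  where "ideal_sum S I = {sum_list xs | xs. set xs \<subseteq> (\<Union>s\<in>S. I s)}"

definition direct :: "'i set \<Rightarrow> ('i \<Rightarrow> 'm::comm_monoid_add set) \<Rightarrow> bool"
  where "direct S I \<longleftrightarrow> (\<forall>i\<in>S. I i \<inter> ideal_sum (S - {i}) I = {0})"

context gamma_monoid
begin

definition order_ideal :: "'m set \<Rightarrow> bool"
  where "order_ideal I \<longleftrightarrow>
    0 \<in> I \<and> (\<forall>x\<in>I. \<forall>y\<in>I. x + y \<in> I) \<and>
    (\<forall>g. \<forall>x\<in>I. act g x \<in> I) \<and>
    (\<forall>x\<in>I. \<forall>y. alg_le y x \<longrightarrow> y \<in> I)"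

definition essential :: "'m set \<Rightarrow> bool"
  where "essential I \<longleftrightarrow>
    order_ideal I \<and> (\<forall>J. order_ideal J \<and> J \<noteq> {0} \<longrightarrow> I \<inter> J \<noteq> {0})"

definition uniform :: "'m set \<Rightarrow> bool"
  where "uniform I \<longleftrightarrow>
    order_ideal I \<and> I \<noteq> {0} \<and>
    (\<forall>J K. order_ideal J \<and> J \<noteq> {0} \<and> J \<subseteq> I \<and> order_ideal K \<and> K \<noteq> {0} \<and> K \<subseteq> I
      \<longrightarrow> J \<inter> K \<noteq> {0})"

definition udim :: enat
  where "udim = Sup {enat k | k. \<exists>I :: nat \<Rightarrow> 'm set.
    (\<forall>i<k. order_ideal (I i) \<and> I i \<noteq> {0}) \<and>
    (\<forall>i<k. \<forall>j<k. i \<noteq> j \<longrightarrow> incomparable (I i) (I j))}"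

definition has_uniform_decomposition :: "nat \<Rightarrow> bool"
  where "has_uniform_decomposition n \<longleftrightarrow>
    (\<exists>E. \<exists>U :: nat \<Rightarrow> 'm set. essential E \<and> (\<forall>i<n. uniform (U i)) \<and>
      direct {..<n} U \<and> E = ideal_sum {..<n} U)"

text \<open>In a conical refinement monoid at most one \<open>n\<close> satisfies
  \<^term>\<open>has_uniform_decomposition n\<close>, so the definite description denotes it.\<close>

definition udim' :: enat
  where "udim' =
    (if \<exists>n. has_uniform_decomposition n then enat (THE n. has_uniform_decomposition n) else \<infinity>)"

end

end

theory Submission imports Defs begin

text \<open>
  Because order ideals are closed downwards, incomparability of two of them is the same as having
  zero intersection. Moreover a summand of an element \<open>x\<close> lies below \<open>x\<close>, so an order ideal \<open>J\<close>
  contains every summand of each of its elements. Hence \<open>J\<close> meets a sum of order ideals nontrivially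
  exactly when it meets one of the terms nontrivially (\<open>meets_ideal_sum\<close>). In particular a sum is
  direct as soon as its terms have pairwise zero intersection, and both dimensions speak of the
  same objects: finite families of nonzero order ideals with pairwise zero intersection, here
  called independent.

  Suppose that an essential ideal is a direct sum of \<open>n\<close> uniform ideals \<open>U s\<close>. These form an
  independent family of size \<open>n\<close>. Conversely each member of an independent family meets the essential
  sum, hence meets some \<open>U s\<close>; two members cannot meet the same \<open>U s\<close>, since \<open>U s\<close> is
  uniform. By the pigeonhole principle no independent family has more than \<open>n\<close> members
  (\<open>independent_card_le\<close>), so the uniform dimension is \<open>n\<close>.

  Suppose that there is no such decomposition. Then an independent family of any size can be
  enlarged by one (\<open>independent_extend\<close>): either a member fails to be uniform and can be replaced by
  two disjoint ideals inside it, or the sum of the family, which is an order ideal by refinement,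
  fails to be essential and misses a nonzero ideal that can be appended. So there are independent
  families of every size and the uniform dimension is infinite.
\<close>

section \<open>Sums of order ideals\<close>

context gamma_monoid
begin

lemma order_ideal_zero: "order_ideal I \<Longrightarrow> 0 \<in> I"
  by (simp add: order_ideal_def)

lemma order_ideal_downward: "order_ideal I \<Longrightarrow> x \<in> I \<Longrightarrow> alg_le y x \<Longrightarrow> y \<in> I"
  unfolding order_ideal_def by blast

lemma order_ideal_Int: "order_ideal I \<Longrightarrow> order_ideal J \<Longrightarrow> order_ideal (I \<inter> J)"
  unfolding order_ideal_def by blast

lemma incomparable_iff_Int:
  assumes I: "order_ideal I" and J: "order_ideal J"
  shows "incomparable I J \<longleftrightarrow> I \<inter> J = {0}"
proof
  have refl: "alg_le a a" for a :: 'm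
    unfolding alg_le_def by (metis add_0_right)
  show "I \<inter> J = {0}" if "incomparable I J"
    using that refl order_ideal_zero[OF I] order_ideal_zero[OF J]
    unfolding incomparable_def by blast
  show "incomparable I J" if "I \<inter> J = {0}"
    using that order_ideal_downward[OF I] order_ideal_downward[OF J]
    unfolding incomparable_def by blast
qed

lemma alg_le_sum_list: "x \<in> set xs \<Longrightarrow> alg_le x (sum_list xs)"
  unfolding alg_le_def
proof (induction xs)
  case (Cons y ys)
  then show ?case
    by (metis add.left_commute set_ConsD sum_list.Cons)
qed simp

lemma sum_list_eq_zero_if_set: "set xs \<subseteq> {0} \<Longrightarrow> sum_list xs = (0 :: 'm)"
  by (induction xs) auto

text \<open>Splitting a nonzero common element into its summands, one of them is nonzero, and it stays
  in \<open>J\<close> because it lies below the element.\<close>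

lemma meets_ideal_sum:
  assumes J: "order_ideal J" and I: "\<And>s. s \<in> S \<Longrightarrow> order_ideal (I s)"
    and meets: "J \<inter> ideal_sum S I \<noteq> {0}"
  obtains s where "s \<in> S" "J \<inter> I s \<noteq> {0}"
proof -
  have "0 \<in> ideal_sum S I"
    unfolding ideal_sum_def by (force intro: exI[of _ "[]"])
  with meets order_ideal_zero[OF J]
  obtain x where x: "x \<in> J" "x \<in> ideal_sum S I" "x \<noteq> 0" by blast
  then obtain xs where xs: "x = sum_list xs" "set xs \<subseteq> (\<Union>s\<in>S. I s)"
    unfolding ideal_sum_def by blast
  with x(3) sum_list_eq_zero_if_set obtain y where y: "y \<in> set xs" "y \<noteq> 0" by blast
  then have "y \<in> J" using order_ideal_downward[OF J x(1)] alg_le_sum_list xs(1) by blast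
  with y xs(2) that show thesis by blast
qed

lemma ideal_sum_upper: "s \<in> S \<Longrightarrow> I s \<subseteq> ideal_sum S I"
proof
  fix x assume "s \<in> S" "x \<in> I s"
  then show "x \<in> ideal_sum S I"
    unfolding ideal_sum_def by (force intro: exI[of _ "[x]"])
qed

lemma direct_iff_pairwise:
  assumes I: "\<And>s. s \<in> S \<Longrightarrow> order_ideal (I s)"
  shows "direct S I \<longleftrightarrow> (\<forall>i\<in>S. \<forall>j\<in>S. i \<noteq> j \<longrightarrow> I i \<inter> I j = {0})"
proof
  assume d: "direct S I"
  show "\<forall>i\<in>S. \<forall>j\<in>S. i \<noteq> j \<longrightarrow> I i \<inter> I j = {0}"
  proof (intro ballI impI)
    fix i j assume ij: "i \<in> S" "j \<in> S" "i \<noteq> j"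
    then have "I j \<subseteq> ideal_sum (S - {i}) I"
      by (intro ideal_sum_upper) auto
    moreover have "I i \<inter> ideal_sum (S - {i}) I = {0}"
      using d ij(1) unfolding direct_def by blast
    ultimately show "I i \<inter> I j = {0}"
      using order_ideal_zero[OF I] ij by blast
  qed
next
  assume p: "\<forall>i\<in>S. \<forall>j\<in>S. i \<noteq> j \<longrightarrow> I i \<inter> I j = {0}"
  show "direct S I"
    unfolding direct_def
  proof (rule ballI, rule ccontr)
    fix i assume i: "i \<in> S" "I i \<inter> ideal_sum (S - {i}) I \<noteq> {0}"
    obtain s where "s \<in> S - {i}" "I i \<inter> I s \<noteq> {0}"
      using meets_ideal_sum[OF I[OF i(1)] _ i(2)] I by blast
    with p i(1) show False by auto
  qed
qed

end

context conical_refinement_gamma_monoid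
begin

text \<open>The Riesz decomposition property: refinement splits \<open>y\<close> along the summands of an element
  above it, and conicality covers the empty sum.\<close>

lemma below_sum_list_decompose:
  fixes A :: "'m set"
  assumes down: "\<And>a b. a \<in> A \<Longrightarrow> alg_le b a \<Longrightarrow> b \<in> A"
  shows "set xs \<subseteq> A \<Longrightarrow> alg_le y (sum_list xs) \<Longrightarrow> \<exists>ys. y = sum_list ys \<and> set ys \<subseteq> A"
proof (induction xs arbitrary: y)
  case Nil
  then obtain c where "y + c = 0"
    unfolding alg_le_def by auto
  then have "y = 0" using conical by blast
  then show ?case by (intro exI[of _ "[]"]) simp
next
  case (Cons x xs)
  then obtain z where "y + z = x + sum_list xs"
    unfolding alg_le_def by auto
  from refinement[OF this] obtain a b c d
    where *: "y = a + b" "x = a + c" "sum_list xs = b + d" by blast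
  then have "a \<in> A" using down[of x a] Cons.prems(1) unfolding alg_le_def by auto
  moreover obtain ys where "b = sum_list ys" "set ys \<subseteq> A"
    using Cons.IH[of b] Cons.prems(1) *(3) unfolding alg_le_def by auto
  ultimately show ?case using *(1) by (intro exI[of _ "a # ys"]) simp
qed

lemma order_ideal_ideal_sum:
  assumes I: "\<And>s. s \<in> S \<Longrightarrow> order_ideal (I s)"
  shows "order_ideal (ideal_sum S I)"
proof -
  let ?A = "\<Union>s\<in>S. I s"
  have act_sum: "act g (sum_list xs) = sum_list (map (act g) xs)" for g xs
    by (induction xs) (simp_all add: act_zero_right act_add_right)
  have act_A: "act g x \<in> ?A" if "x \<in> ?A" for g x
    using that I unfolding order_ideal_def by blast
  have down: "b \<in> ?A" if "a \<in> ?A" "alg_le b a" for a b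
    using that order_ideal_downward[OF I] by blast
  have mem: "x \<in> ideal_sum S I \<longleftrightarrow> (\<exists>xs. x = sum_list xs \<and> set xs \<subseteq> ?A)" for x
    unfolding ideal_sum_def by blast
  have "0 \<in> ideal_sum S I"
    unfolding mem by (intro exI[of _ "[]"]) simp
  moreover have "x + y \<in> ideal_sum S I" if x: "x \<in> ideal_sum S I" and y: "y \<in> ideal_sum S I" for x y
  proof -
    obtain xs ys where "x = sum_list xs" "set xs \<subseteq> ?A" "y = sum_list ys" "set ys \<subseteq> ?A"
      using x y unfolding mem by blast
    then show ?thesis unfolding mem by (intro exI[of _ "xs @ ys"]) auto
  qed
  moreover have "act g x \<in> ideal_sum S I" if x: "x \<in> ideal_sum S I" for g x
  proof -
    obtain xs where xs: "x = sum_list xs" "set xs \<subseteq> ?A" using x unfolding mem by blast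
    have "act g x = sum_list (map (act g) xs)" using xs(1) act_sum by simp
    moreover have "set (map (act g) xs) \<subseteq> ?A"
      unfolding set_map by (rule image_subsetI, rule act_A, rule subsetD[OF xs(2)])
    ultimately show ?thesis unfolding mem by blast
  qed
  moreover have "y \<in> ideal_sum S I" if x: "x \<in> ideal_sum S I" and le: "alg_le y x" for x y
  proof -
    obtain xs where "x = sum_list xs" "set xs \<subseteq> ?A" using x unfolding mem by blast
    then show ?thesis
      unfolding mem using below_sum_list_decompose[of ?A xs y] down le by blast
  qed
  ultimately show ?thesis unfolding order_ideal_def by blast
qed

end

section \<open>Independent families\<close>

context gamma_monoid
begin

definition independent :: "nat \<Rightarrow> (nat \<Rightarrow> 'm set) \<Rightarrow> bool"
  where "independent k I \<longleftrightarrow>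
    (\<forall>i<k. order_ideal (I i) \<and> I i \<noteq> {0}) \<and> (\<forall>i<k. \<forall>j<k. i \<noteq> j \<longrightarrow> I i \<inter> I j = {0})"

lemma udim_eq_Sup_independent: "udim = Sup {enat k | k. \<exists>I. independent k I}"
proof -
  have "(\<forall>i<k. order_ideal (I i) \<and> I i \<noteq> {0}) \<and>
      (\<forall>i<k. \<forall>j<k. i \<noteq> j \<longrightarrow> incomparable (I i) (I j)) \<longleftrightarrow> independent k I" for k I
    unfolding independent_def by (simp add: incomparable_iff_Int cong: conj_cong)
  then show ?thesis unfolding udim_def by simp
qed

lemma uniform_direct_iff_independent:
  "(\<forall>i<n. uniform (U i)) \<and> direct {..<n} U \<longleftrightarrow> (\<forall>i<n. uniform (U i)) \<and> independent n U"
proof (cases "\<forall>i<n. uniform (U i)")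
  case True
  then have U: "\<And>i. i < n \<Longrightarrow> order_ideal (U i) \<and> U i \<noteq> {0}"
    unfolding uniform_def by blast
  then have "direct {..<n} U \<longleftrightarrow> independent n U"
    by (subst direct_iff_pairwise) (simp_all add: independent_def Ball_def)
  then show ?thesis by blast
qed auto

lemma has_uniform_decomposition_iff:
  "has_uniform_decomposition n \<longleftrightarrow>
    (\<exists>U. (\<forall>i<n. uniform (U i)) \<and> independent n U \<and> essential (ideal_sum {..<n} U))"
  unfolding has_uniform_decomposition_def using uniform_direct_iff_independent by blast

text \<open>Sending each \<open>I i\<close> to some uniform \<open>U s\<close> that it meets is injective: two nonzero ideals inside
  one \<open>U s\<close> intersect, while \<open>I i\<close> and \<open>I j\<close> do not.\<close>

lemma independent_card_le:
  assumes U: "\<forall>s<n. uniform (U s)" and ess: "essential (ideal_sum {..<n} U)"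
    and ind: "independent k I"
  shows "k \<le> n"
proof -
  have U': "order_ideal (U s)" if "s < n" for s
    using that U unfolding uniform_def by blast
  have I: "order_ideal (I i)" "I i \<noteq> {0}" if "i < k" for i
    using that ind unfolding independent_def by auto
  have "\<exists>s<n. I i \<inter> U s \<noteq> {0}" if i: "i < k" for i
  proof -
    have "I i \<inter> ideal_sum {..<n} U \<noteq> {0}"
      using ess I[OF i] unfolding essential_def by (metis Int_commute)
    from meets_ideal_sum[OF I(1)[OF i] _ this] U' show ?thesis by blast
  qed
  then obtain f where f: "\<And>i. i < k \<Longrightarrow> f i < n" "\<And>i. i < k \<Longrightarrow> I i \<inter> U (f i) \<noteq> {0}"
    by metis
  have "inj_on f {..<k}"
  proof (rule inj_onI, rule ccontr)
    fix i j assume "i \<in> {..<k}" "j \<in> {..<k}" and eq: "f i = f j" and ne: "i \<noteq> j"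
    then have ij: "i < k" "j < k" by auto
    let ?s = "f i"
    have "order_ideal (I i \<inter> U ?s)" "order_ideal (I j \<inter> U ?s)"
      using order_ideal_Int I(1) U' f(1) ij by blast+
    moreover have "I i \<inter> U ?s \<noteq> {0}" "I j \<inter> U ?s \<noteq> {0}"
      using f(2) ij eq by metis+
    moreover have "uniform (U ?s)" using U f(1) ij by blast
    ultimately have "(I i \<inter> U ?s) \<inter> (I j \<inter> U ?s) \<noteq> {0}"
      unfolding uniform_def by (meson Int_lower2)
    moreover have "I i \<inter> I j = {0}"
      using ind ij ne unfolding independent_def by blast
    ultimately show False
      using order_ideal_zero[OF U'[OF f(1)[OF ij(1)]]] by blast
  qed
  moreover have "f ` {..<k} \<subseteq> {..<n}" using f(1) by auto
  ultimately have "card {..<k} \<le> card {..<n}"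
    by (intro card_inj_on_le) auto
  then show ?thesis by simp
qed

lemma independent_append:
  assumes ind: "independent k I" and J: "order_ideal J" "J \<noteq> {0}"
    and disj: "\<And>i. i < k \<Longrightarrow> I i \<inter> J = {0}"
  shows "independent (Suc k) (I(k := J))"
  using assms unfolding independent_def by (auto simp: less_Suc_eq Int_commute)

lemma independent_shrink:
  assumes ind: "independent k I" and J: "order_ideal J" "J \<noteq> {0}" and sub: "J \<subseteq> I i"
  shows "independent k (I(i := J))"
proof -
  have "J \<inter> I j = {0}" "I j \<inter> J = {0}" if ij: "i < k" "j < k" "j \<noteq> i" for j
  proof -
    have "I i \<inter> I j = {0}" "order_ideal (I j)"
      using ind ij unfolding independent_def by auto
    then show "J \<inter> I j = {0}" "I j \<inter> J = {0}"
      using sub order_ideal_zero[OF J(1)] order_ideal_zero by blast+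
  qed
  then show ?thesis using ind J unfolding independent_def by auto
qed

end

section \<open>Comparison of the two dimensions\<close>

context conical_refinement_gamma_monoid
begin

lemma independent_extend:
  assumes ind: "independent k I" and no: "\<not> has_uniform_decomposition k"
  shows "\<exists>I'. independent (Suc k) I'"
proof (cases "\<forall>i<k. uniform (I i)")
  case True
  have I: "order_ideal (I i)" if "i < k" for i
    using that ind unfolding independent_def by blast
  have oi: "order_ideal (ideal_sum {..<k} I)"
    using I by (intro order_ideal_ideal_sum) auto
  have "\<not> essential (ideal_sum {..<k} I)"
    using no ind True unfolding has_uniform_decomposition_iff by blast
  then obtain J where J: "order_ideal J" "J \<noteq> {0}" "ideal_sum {..<k} I \<inter> J = {0}"
    using oi unfolding essential_def by blast
  have "I i \<inter> J = {0}" if "i < k" for i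
    using ideal_sum_upper[of i "{..<k}" I] that J(3) order_ideal_zero[OF I[OF that]]
      order_ideal_zero[OF J(1)] by blast
  with independent_append[OF ind J(1,2)] show ?thesis by blast
next
  case False
  then obtain i where i: "i < k" "\<not> uniform (I i)" by blast
  moreover have I: "order_ideal (I i)" "I i \<noteq> {0}"
    using i(1) ind unfolding independent_def by auto
  ultimately obtain J K where J: "order_ideal J" "J \<noteq> {0}" "J \<subseteq> I i"
    and K: "order_ideal K" "K \<noteq> {0}" "K \<subseteq> I i" and JK: "J \<inter> K = {0}"
    unfolding uniform_def by blast
  have "(I(i := J)) j \<inter> K = {0}" if j: "j < k" for j
  proof (cases "j = i")
    case False
    then have "I j \<inter> I i = {0}" "order_ideal (I j)"
      using ind i(1) j unfolding independent_def by auto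
    then show ?thesis
      using False K(3) order_ideal_zero[OF K(1)] order_ideal_zero by auto
  qed (simp add: JK)
  with independent_append[OF independent_shrink[OF ind J] K(1,2)] show ?thesis by blast
qed

lemma udim_eq_if_decomposition:
  assumes "has_uniform_decomposition n"
  shows "udim = enat n"
proof -
  obtain U where U: "\<forall>i<n. uniform (U i)" "independent n U" "essential (ideal_sum {..<n} U)"
    using assms unfolding has_uniform_decomposition_iff by blast
  show ?thesis
    unfolding udim_eq_Sup_independent
  proof (rule antisym)
    show "Sup {enat k |k. \<exists>I. independent k I} \<le> enat n"
      using independent_card_le[OF U(1,3)] by (auto intro!: Sup_least)
    show "enat n \<le> Sup {enat k |k. \<exists>I. independent k I}"
      using U(2) by (auto intro!: Sup_upper)
  qed
qed

lemma udim_infinite_if_no_decomposition: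
  assumes "\<nexists>n. has_uniform_decomposition n"
  shows "udim = \<infinity>"
proof -
  have ex: "\<exists>I. independent k I" for k
  proof (induction k)
    case 0
    show ?case unfolding independent_def by simp
  next
    case (Suc k)
    then show ?case using independent_extend assms by blast
  qed
  have le: "enat k \<le> udim" for k
    unfolding udim_eq_Sup_independent using ex by (auto intro: Sup_upper)
  show ?thesis
  proof (cases udim)
    case (enat m)
    with le[of "Suc m"] show ?thesis by simp
  qed
qed

text \<open>The uniqueness of \<open>n\<close> behind the definite description is part of
  \<open>udim_eq_if_decomposition\<close>, because the uniform dimension determines \<open>n\<close>.\<close>

lemma udim'_eq_udim: "udim' = udim"
proof (cases "\<exists>n. has_uniform_decomposition n")
  case True
  then obtain n where n: "has_uniform_decomposition n" by blast
  have "(THE m. has_uniform_decomposition m) = n"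
    using n udim_eq_if_decomposition by (metis enat.inject the_equality)
  then show ?thesis
    using True udim_eq_if_decomposition[OF n] unfolding udim'_def by simp
next
  case False
  then show ?thesis using udim_infinite_if_no_decomposition unfolding udim'_def by simp
qed

end

theorem corollary2p13:
  fixes act :: "'g::ab_group_add \<Rightarrow> 'm::comm_monoid_add \<Rightarrow> 'm"
  assumes "conical_refinement_gamma_monoid act"
  shows "gamma_monoid.udim' act = gamma_monoid.udim act"
  using conical_refinement_gamma_monoid.udim'_eq_udim[OF assms] .

end
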